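(* Let $A$, $B$, $C$, $D$ be linear endomorphisms of $V$, each self-adjoint or skew-adjoint, forming a chain complex $$V\xrightarrow{\;A\;}V\xrightarrow{\;B\;}V\xrightarrow{\;C\;}V\xrightarrow{\;D\;}V,$$ i.e. $BA=0$, $CB=0$ and $DC=0$. Suppose $R_A+\epsilon_1R_B+\epsilon_2R_C+\epsilon_3R_D=0$ with $\epsilon_1,\epsilon_2,\epsilon_3\in\{1,-1\}$, and that $\operatorname{Rank}(B)\ge 4$ and $\operatorname{Rank}(C)\ge 4$. Then $R_A$ and $R_C$ are the same build, and $R_B$ and $R_D$ are the same build. Moreover, $B^3=\pm BDB$, $C^3=\pm CAC$, $\epsilon_2=-1$, and $\epsilon_1=-\epsilon_3$.
   Context: $V$ is a finite-dimensional real vector space, $\phi$ a positive definite inner product on $V$, and $A^*$ the adjoint of $A$ with respect to $\phi$. For an endomorphism $A$ of $V$, $$R^S_{A}(x,y,z,w)= \phi (Ax,w) \phi (Ay,z) - \phi (Ax,z) \phi (Ay,w),$$ $$R^{\Lambda}_{A} (x,y,z,w) =\phi (Ax,w) \phi (Ay,z) - \phi (Ax,z) \phi (Ay,w) -2 \phi (Ax,y) \phi (Az,w).$$ The symbol $R_A$ without superscript means $R^S_A$ (symmetric build) if $A=A^*$ and $R^{\Lambda}_A$ (anti-symmetric build) if $A=-A^*$; a priori the builds of the different tensors may differ. Two tensors $R_A$, $R_C$ are the same build if $A,C$ are both self-adjoint or both skew-adjoint. *)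

theory Defs
  imports "HOL-Analysis.Analysis"
begin

definition self_adjoint :: "('v::euclidean_space \<Rightarrow> 'v) \<Rightarrow> bool" where
  "self_adjoint A \<longleftrightarrow> linear A \<and> adjoint A = A"

definition skew_adjoint :: "('v::euclidean_space \<Rightarrow> 'v) \<Rightarrow> bool" where
  "skew_adjoint A \<longleftrightarrow> linear A \<and> adjoint A = (\<lambda>x. - A x)"

definition R_sym :: "('v::euclidean_space \<Rightarrow> 'v) \<Rightarrow> 'v \<Rightarrow> 'v \<Rightarrow> 'v \<Rightarrow> 'v \<Rightarrow> real" where
  "R_sym A x y z w = (A x \<bullet> w) * (A y \<bullet> z) - (A x \<bullet> z) * (A y \<bullet> w)"

definition R_anti :: "('v::euclidean_space \<Rightarrow> 'v) \<Rightarrow> 'v \<Rightarrow> 'v \<Rightarrow> 'v \<Rightarrow> 'v \<Rightarrow> real" where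
  "R_anti A x y z w =
     (A x \<bullet> w) * (A y \<bullet> z) - (A x \<bullet> z) * (A y \<bullet> w) - 2 * (A x \<bullet> y) * (A z \<bullet> w)"

text \<open>The tensor \<open>R_A\<close> without superscript, for \<open>A\<close> self-adjoint or skew-adjoint. The only
  endomorphism that is both is \<open>0\<close>, where the two builds agree; for an \<open>A\<close> that is neither,
  the value is irrelevant.\<close>

definition R_canon :: "('v::euclidean_space \<Rightarrow> 'v) \<Rightarrow> 'v \<Rightarrow> 'v \<Rightarrow> 'v \<Rightarrow> 'v \<Rightarrow> real" where
  "R_canon A = (if self_adjoint A then R_sym A else R_anti A)"

definition same_build :: "('v::euclidean_space \<Rightarrow> 'v) \<Rightarrow> ('v \<Rightarrow> 'v) \<Rightarrow> bool" where
  "same_build A C \<longleftrightarrow> (self_adjoint A \<and> self_adjoint C) \<or> (skew_adjoint A \<and> skew_adjoint C)"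

end

theory Submission
  imports Defs
begin

text \<open>
  A product \<open>T S\<close> of endomorphisms that are self- or skew-adjoint vanishes as soon as \<open>S T\<close> does, so
  in the chain complex \<open>A B\<close>, \<open>B C\<close> and \<open>C D\<close> vanish as well.  Insert vectors
  \<open>B x, B y, B z, B w\<close> into the linear relation: the tensors of \<open>A\<close> and \<open>C\<close> drop out, and moving the
  outer \<open>B\<close> to the left side of every inner product turns the other two into the tensors of \<open>B\<^sup>3\<close> and
  \<open>B D B\<close>, the adjunction signs occurring in pairs.  What is left is a relation between \<^emph>\<open>two\<close>
  tensors.  Inserting vectors from the range of \<open>C\<close> gives in the same way a relation between the
  tensors of \<open>C\<^sup>3\<close> and \<open>C A C\<close>.

  Two canonical tensors that are proportional are rigid once one of the endomorphisms has rank at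
  least three.  If the builds differ, evaluating on \<open>(x, y, x, w)\<close> confines the range to a plane
  (\<open>rank_le_2_if_R_sym_eq_R_anti\<close>, \<open>rank_le_2_if_R_anti_eq_R_sym\<close>).  If they agree, then \<open>S x\<close> is a
  multiple of \<open>T x\<close> for every \<open>x\<close>, hence \<open>S = l T\<close> for one scalar \<open>l\<close>, and comparing the tensors,
  which are quadratic in the endomorphism, gives \<open>c l\<^sup>2 = 1\<close> for the ratio \<open>c\<close> of the tensors
  (\<open>R_sym_rigid\<close>, \<open>R_anti_rigid\<close>).  As the coefficients in the relation are signs, \<open>c = 1\<close> and
  \<open>l = \<plusminus>1\<close>.  Cubing does not lower the rank of \<open>B\<close>, since the kernel of an
  endomorphism that is self- or skew-adjoint meets its range trivially, so rigidity applies to \<open>B\<^sup>3\<close>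
  and \<open>B D B\<close>, and everything claimed can be read off.
\<close>

section \<open>Vectors, spans and ranks\<close>

lemma separate_from_line:
  fixes u v :: "'v::euclidean_space"
  assumes "u \<notin> span {v}"
  obtains z where "v \<bullet> z = 0" and "u \<bullet> z \<noteq> 0"
proof -
  \<comment> \<open>The component of \<open>u\<close> orthogonal to \<open>v\<close>; for \<open>v = 0\<close> the quotient is \<open>0\<close> and \<open>z = u\<close>.\<close>
  define k where "k = (u \<bullet> v) / (v \<bullet> v)"
  define z where "z = u - k *\<^sub>R v"
  have vz: "v \<bullet> z = 0"
    by (cases "v = 0") (simp_all add: z_def k_def inner_diff_right inner_commute)
  have "z \<noteq> 0"
    using assms by (auto simp: z_def span_singleton)
  then have "z \<bullet> z \<noteq> 0" by simp
  moreover have "z \<bullet> z = u \<bullet> z"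
    using vz by (subst (1) z_def) (simp add: inner_diff_left)
  ultimately show thesis
    using vz that by auto
qed

lemma in_span_pair_if_inner_eq:
  fixes u p q :: "'v::euclidean_space"
  assumes "k \<noteq> 0" and "\<And>w. k * (u \<bullet> w) = a * (p \<bullet> w) + b * (q \<bullet> w)"
  shows "u \<in> span {p, q}"
proof -
  have "(k *\<^sub>R u) \<bullet> w = (a *\<^sub>R p + b *\<^sub>R q) \<bullet> w" for w
    using assms(2)[of w] by (simp add: inner_add_left)
  then have "k *\<^sub>R u = a *\<^sub>R p + b *\<^sub>R q"
    by (metis vector_eq_rdot)
  moreover have "a *\<^sub>R p + b *\<^sub>R q \<in> span {p, q}"
    by (simp add: span_add span_scale span_base)
  ultimately have "(1 / k) *\<^sub>R (k *\<^sub>R u) \<in> span {p, q}"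
    by (metis span_scale)
  then show ?thesis using assms(1) by simp
qed

text \<open>With \<open>p = q\<close> or \<open>p = q = 0\<close> this also serves when the range is a line or zero.\<close>

lemma dim_le_2_if_subset_span_pair:
  fixes U :: "'v::euclidean_space set"
  assumes "U \<subseteq> span {p, q}"
  shows "dim U \<le> 2"
proof -
  have "dim U \<le> card {p, q}"
    using dim_mono[OF assms] dim_le_card[of "{p, q}" "{p, q}"] by (simp add: span_superset)
  also have "\<dots> \<le> 2" by (simp add: card_insert_if)
  finally show ?thesis .
qed

text \<open>Comparing \<open>S (x + y)\<close> with \<open>S x\<close> and \<open>S y\<close> equates the factors at \<open>x\<close> and \<open>y\<close> when \<open>T x\<close> and
  \<open>T y\<close> are independent.  When they are dependent, a combination of \<open>x\<close> and \<open>y\<close> lies in the kernel of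
  \<open>T\<close>, which the hypothesis places inside the kernel of \<open>S\<close>.\<close>

lemma scalar_multiple_if_pointwise:
  fixes S T :: "'v::euclidean_space \<Rightarrow> 'v"
  assumes "linear S" and "linear T" and S: "\<And>x. S x \<in> span {T x}"
  obtains l where "\<And>x. S x = l *\<^sub>R T x"
proof (cases "\<forall>x. T x = 0")
  case True
  with S show thesis by (intro that[of 0]) simp
next
  case False
  then obtain x where x: "T x \<noteq> 0" by auto
  from S[of x] obtain l where l: "S x = l *\<^sub>R T x" by (auto simp: span_singleton)
  have "S y = l *\<^sub>R T y" for y
  proof (cases "T y \<in> span {T x}")
    case True
    then obtain c where c: "T y = c *\<^sub>R T x" by (auto simp: span_singleton)
    then have "T (y - c *\<^sub>R x) = 0"
      using \<open>linear T\<close> by (simp add: linear_diff linear_scale)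
    then have "S (y - c *\<^sub>R x) = 0" using S[of "y - c *\<^sub>R x"] by simp
    then show ?thesis
      using \<open>linear S\<close> c l by (simp add: linear_diff linear_scale)
  next
    case False
    from S[of y] obtain m where m: "S y = m *\<^sub>R T y" by (auto simp: span_singleton)
    from S[of "x + y"] obtain n where n: "S (x + y) = n *\<^sub>R T (x + y)"
      by (auto simp: span_singleton)
    then have "(m - n) *\<^sub>R T y = (n - l) *\<^sub>R T x"
      using \<open>linear S\<close> \<open>linear T\<close> l m by (simp add: linear_add algebra_simps)
    moreover have "m = n"
    proof (rule ccontr)
      assume "m \<noteq> n"
      then have "T y = (1 / (m - n)) *\<^sub>R ((m - n) *\<^sub>R T y)" by simp
      also have "\<dots> = ((n - l) / (m - n)) *\<^sub>R T x"
        by (subst \<open>(m - n) *\<^sub>R T y = (n - l) *\<^sub>R T x\<close>) simp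
      finally show False using False by (auto simp: span_singleton)
    qed
    ultimately show ?thesis using x m by simp
  qed
  then show thesis by (rule that)
qed

section \<open>Self- and skew-adjoint endomorphisms\<close>

lemma self_adjoint_inner: "self_adjoint T \<Longrightarrow> T x \<bullet> y = T y \<bullet> x"
  by (metis adjoint_works inner_commute self_adjoint_def)

lemma skew_adjoint_inner: "skew_adjoint T \<Longrightarrow> T x \<bullet> y = - (T y \<bullet> x)"
  by (metis adjoint_works inner_commute inner_minus_right skew_adjoint_def)

lemma self_adjointI:
  assumes "linear T" and "\<And>x y. T x \<bullet> y = T y \<bullet> x"
  shows "self_adjoint T"
proof -
  have "\<forall>x y. x \<bullet> T y = T x \<bullet> y"
    using assms(2) by (metis inner_commute)
  then show ?thesis
    using assms(1) by (simp add: self_adjoint_def adjoint_unique inner_commute)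
qed

lemma skew_adjointI:
  assumes "linear T" and "\<And>x y. T x \<bullet> y = - (T y \<bullet> x)"
  shows "skew_adjoint T"
proof -
  have "\<forall>x y. x \<bullet> - T y = T x \<bullet> y"
    using assms(2) by (metis inner_commute inner_minus_left)
  then show ?thesis
    using assms(1) by (simp add: skew_adjoint_def adjoint_unique inner_commute)
qed

text \<open>Arguments that do not depend on the build only see the sign of the adjunction.\<close>

lemma adjoint_sign:
  assumes "self_adjoint T \<or> skew_adjoint T"
  obtains s :: real where "s * s = 1" and "\<And>x y. T x \<bullet> y = s * (x \<bullet> T y)"
  using assms
proof
  assume "self_adjoint T"
  then show thesis
    by (intro that[of 1]) (simp, metis self_adjoint_inner inner_commute mult_1)
next
  assume "skew_adjoint T"
  then show thesis
    by (intro that[of "-1"]) (simp, metis skew_adjoint_inner inner_commute mult_minus1)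
qed

lemma self_adjoint_eq_0_if_quadratic_form_eq_0:
  assumes "self_adjoint T" and "\<And>x. T x \<bullet> x = 0"
  shows "T x = 0"
proof -
  have "T x \<bullet> y = 0" for y
    using assms(2)[of "x + y"] assms(2)[of x] assms(2)[of y] self_adjoint_inner[OF assms(1), of x y]
      assms(1)
    by (simp add: self_adjoint_def linear_add inner_add_left inner_add_right)
  then show ?thesis by (metis inner_eq_zero_iff)
qed

lemma skew_adjoint_inner_self: "skew_adjoint T \<Longrightarrow> T x \<bullet> x = 0"
  using skew_adjoint_inner[of T x x] by simp

lemma comp_eq_0_commute:
  fixes S T :: "'v::euclidean_space \<Rightarrow> 'v"
  assumes "self_adjoint S \<or> skew_adjoint S" and "self_adjoint T \<or> skew_adjoint T"
    and "S \<circ> T = (\<lambda>x. 0)"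
  shows "T \<circ> S = (\<lambda>x. 0)"
proof
  fix x
  obtain s where s: "\<And>x y. S x \<bullet> y = s * (x \<bullet> S y)" using adjoint_sign[OF assms(1)] by metis
  obtain t where t: "\<And>x y. T x \<bullet> y = t * (x \<bullet> T y)" using adjoint_sign[OF assms(2)] by metis
  have "S (T y) = 0" for y using fun_cong[OF assms(3), of y] by simp
  then have "T (S x) \<bullet> T (S x) = 0"
    by (subst t, subst s) simp
  then show "(T \<circ> S) x = 0" by simp
qed

lemma kernel_square:
  fixes T :: "'v::euclidean_space \<Rightarrow> 'v"
  assumes "self_adjoint T \<or> skew_adjoint T" and "T (T x) = 0"
  shows "T x = 0"
proof -
  obtain s where "T x \<bullet> T x = s * (x \<bullet> T (T x))"
    using adjoint_sign[OF assms(1)] by metis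
  then show ?thesis using assms(2) by simp
qed

lemma rank_cube:
  fixes T :: "'v::euclidean_space \<Rightarrow> 'v"
  assumes T: "self_adjoint T \<or> skew_adjoint T"
  shows "dim (range (T ^^ 3)) = dim (range T)"
proof -
  have lin: "linear T" using T by (auto simp: self_adjoint_def skew_adjoint_def)
  then have lin2: "linear (T \<circ> T)" by (simp add: linear_compose)
  have "inj_on (T \<circ> T) (range T)"
  proof (rule inj_onI)
    fix u v assume "u \<in> range T" "v \<in> range T" "(T \<circ> T) u = (T \<circ> T) v"
    then obtain a b where "u = T a" "v = T b" "T (T (T a)) = T (T (T b))" by auto
    then have x: "u - v = T (a - b)" and "T (T (T (a - b))) = 0"
      using lin by (simp_all add: linear_diff)
    then have "T (a - b) = 0" using kernel_square[OF T] by blast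
    with x show "u = v" by simp
  qed
  moreover have "span (range T) = range T"
    using linear_subspace_image[OF lin subspace_UNIV] by (simp only: span_eq_iff)
  ultimately have "dim ((T \<circ> T) ` range T) = dim (range T)"
    using lin2 by (intro dim_image_eq) (simp_all only:)
  moreover have "(T \<circ> T) ` range T = range (T ^^ 3)"
    by (auto simp: numeral_3_eq_3)
  ultimately show ?thesis by simp
qed

section \<open>Rigidity of a pair of canonical tensors\<close>

text \<open>On \<open>(x, y, x, w)\<close> the skew-adjoint side is a multiple of \<open>S x \<bullet> w\<close>.  If \<open>T x \<bullet> x \<noteq> 0\<close> for some
  \<open>x\<close>, the relation therefore expresses every \<open>T y\<close> through \<open>T x\<close> and \<open>S x\<close>.\<close>

lemma rank_le_2_if_R_sym_eq_R_anti:
  fixes S T :: "'v::euclidean_space \<Rightarrow> 'v"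
  assumes T: "self_adjoint T" and S: "skew_adjoint S"
    and eq: "\<And>x y z w. R_sym T x y z w = c * R_anti S x y z w"
  shows "dim (range T) \<le> 2"
proof (cases "\<forall>x. T x \<bullet> x = 0")
  case True
  then have "range T \<subseteq> span {0, 0}"
    using self_adjoint_eq_0_if_quadratic_form_eq_0[OF T] by auto
  then show ?thesis by (rule dim_le_2_if_subset_span_pair)
next
  case False
  then obtain x where x: "T x \<bullet> x \<noteq> 0" by auto
  have "T y \<in> span {T x, S x}" for y
  proof (rule in_span_pair_if_inner_eq[OF x])
    fix w
    show "(T x \<bullet> x) * (T y \<bullet> w) = (T y \<bullet> x) * (T x \<bullet> w) + (3 * c * (S x \<bullet> y)) * (S x \<bullet> w)"
      using eq[of x y x w] skew_adjoint_inner_self[OF S, of x] skew_adjoint_inner[OF S, of y x]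
      by (simp add: R_sym_def R_anti_def algebra_simps)
  qed
  then show ?thesis by (intro dim_le_2_if_subset_span_pair) auto
qed

text \<open>Here the rank bound first falls on \<open>S\<close>, and the same evaluation places the range of \<open>T\<close> inside
  that of \<open>S\<close>.\<close>

lemma rank_le_2_if_R_anti_eq_R_sym:
  fixes S T :: "'v::euclidean_space \<Rightarrow> 'v"
  assumes T: "skew_adjoint T" and S: "self_adjoint S"
    and eq: "\<And>x y z w. R_anti T x y z w = c * R_sym S x y z w"
  shows "dim (range T) \<le> 2"
proof -
  have eq': "3 * (T x \<bullet> y) * (T x \<bullet> w) = c * (S x \<bullet> x) * (S y \<bullet> w) - c * (S y \<bullet> x) * (S x \<bullet> w)"
    for x y w
    using eq[of x y x w] skew_adjoint_inner_self[OF T, of x] skew_adjoint_inner[OF T, of y x]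
    by (simp add: R_sym_def R_anti_def algebra_simps)
  show ?thesis
  proof (cases "\<forall>x. c * (S x \<bullet> x) = 0")
    case True
    then have "c = 0 \<or> (\<forall>x. S x = 0)"
      using self_adjoint_eq_0_if_quadratic_form_eq_0[OF S] by auto
    then have "T x \<bullet> T x = 0" for x
      using eq'[of x "T x" "T x"] by auto
    then have "range T \<subseteq> span {0, 0}" by auto
    then show ?thesis by (rule dim_le_2_if_subset_span_pair)
  next
    case False
    then obtain x where x: "c * (S x \<bullet> x) \<noteq> 0" by blast
    have S_span: "S y \<in> span {S x, T x}" for y
    proof (rule in_span_pair_if_inner_eq[OF x])
      fix w
      show "(c * (S x \<bullet> x)) * (S y \<bullet> w)
        = (c * (S y \<bullet> x)) * (S x \<bullet> w) + (3 * (T x \<bullet> y)) * (T x \<bullet> w)"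
        using eq'[of x y w] by simp
    qed
    have "T y \<in> span {S x, T x}" for y
    proof (cases "T y = 0")
      case True
      then show ?thesis by (simp add: span_zero)
    next
      case False
      then have "T y \<in> span {S (T y), S y}"
        using eq'[of y "T y"]
        by (intro in_span_pair_if_inner_eq[where k = "3 * (T y \<bullet> T y)"
              and a = "c * (S y \<bullet> y)" and b = "- (c * (S (T y) \<bullet> y))"]) auto
      moreover have "span {S (T y), S y} \<subseteq> span {S x, T x}"
        using S_span by (intro span_minimal) auto
      ultimately show ?thesis by blast
    qed
    then show ?thesis by (intro dim_le_2_if_subset_span_pair) auto
  qed
qed

text \<open>For fixed \<open>x\<close> and \<open>y\<close> the tensor is the bivector \<open>T x \<and> T y\<close>.  If \<open>S x\<close> left the line through
  \<open>T x\<close> for a single \<open>x\<close>, contracting with a vector that separates them would confine the range of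
  \<open>S\<close> to a plane; contracting the left-hand side confines the range of \<open>T\<close> to the same plane.\<close>

lemma R_sym_rigid:
  fixes S T :: "'v::euclidean_space \<Rightarrow> 'v"
  assumes linT: "linear T" and linS: "linear S" and rank: "dim (range T) \<ge> 3" and c: "c \<noteq> 0"
    and eq: "\<And>x y z w. R_sym T x y z w = c * R_sym S x y z w"
  obtains l where "c * l\<^sup>2 = 1" and "\<And>x. S x = l *\<^sub>R T x"
proof -
  have indep: "\<exists>y. T y \<notin> span {T x}" for x
  proof (rule ccontr)
    assume "\<nexists>y. T y \<notin> span {T x}"
    then have "range T \<subseteq> span {T x, T x}" by auto
    then have "dim (range T) \<le> 2" by (rule dim_le_2_if_subset_span_pair)
    with rank show False by simp
  qed
  have "S x \<in> span {T x}" for x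
  proof (rule ccontr)
    assume "S x \<notin> span {T x}"
    then obtain z where z: "T x \<bullet> z = 0" "S x \<bullet> z \<noteq> 0" by (rule separate_from_line)
    have S_span: "S y \<in> span {S x, T x}" for y
    proof (rule in_span_pair_if_inner_eq)
      show "c * (S x \<bullet> z) \<noteq> 0" using c z by simp
      show "(c * (S x \<bullet> z)) * (S y \<bullet> w) = (c * (S y \<bullet> z)) * (S x \<bullet> w) + (- (T y \<bullet> z)) * (T x \<bullet> w)"
        for w
        using eq[of x y z w] z by (simp add: R_sym_def algebra_simps)
    qed
    have "T y \<in> span {S x, T x}" for y
    proof -
      obtain y' where "T y' \<notin> span {T y}" using indep by blast
      then obtain v where v: "T y \<bullet> v = 0" "T y' \<bullet> v \<noteq> 0" by (rule separate_from_line)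
      have "T y \<in> span {S y, S y'}"
      proof (rule in_span_pair_if_inner_eq[OF v(2)])
        show "(T y' \<bullet> v) * (T y \<bullet> w) = (c * (S y' \<bullet> v)) * (S y \<bullet> w) + (- (c * (S y \<bullet> v))) * (S y' \<bullet> w)"
          for w
          using eq[of y y' v w] v by (simp add: R_sym_def algebra_simps)
      qed
      moreover have "span {S y, S y'} \<subseteq> span {S x, T x}"
        using S_span by (intro span_minimal) auto
      ultimately show ?thesis by blast
    qed
    then have "dim (range T) \<le> 2" by (intro dim_le_2_if_subset_span_pair) auto
    with rank show False by simp
  qed
  then obtain l where l: "\<And>x. S x = l *\<^sub>R T x"
    using scalar_multiple_if_pointwise[OF linS linT] by blast
  have "c * l\<^sup>2 = 1"
  proof -
    obtain x where x: "T x \<notin> span {T 0}" using indep by blast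
    then have x0: "T x \<noteq> 0" by (auto simp: span_zero)
    obtain y where "T y \<notin> span {T x}" using indep by blast
    then obtain z where z: "T x \<bullet> z = 0" "T y \<bullet> z \<noteq> 0" by (rule separate_from_line)
    have "(T x \<bullet> T x) * (T y \<bullet> z) = c * l\<^sup>2 * ((T x \<bullet> T x) * (T y \<bullet> z))"
      using eq[of x y z "T x"] z by (simp add: R_sym_def l power2_eq_square algebra_simps)
    then show ?thesis using x0 z by simp
  qed
  then show thesis using l that by blast
qed

text \<open>The value on \<open>(x, y, x, y)\<close> is \<open>-3 (T x \<bullet> y)\<^sup>2\<close>, so everything orthogonal to \<open>T x\<close> is orthogonal
  to \<open>S x\<close>.\<close>

lemma R_anti_rigid:
  fixes S T :: "'v::euclidean_space \<Rightarrow> 'v"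
  assumes T: "skew_adjoint T" and S: "skew_adjoint S" and ne: "T u \<noteq> 0" and c: "c \<noteq> 0"
    and eq: "\<And>x y z w. R_anti T x y z w = c * R_anti S x y z w"
  obtains l where "c * l\<^sup>2 = 1" and "\<And>x. S x = l *\<^sub>R T x"
proof -
  have sq: "(T x \<bullet> y)\<^sup>2 = c * (S x \<bullet> y)\<^sup>2" for x y
    using eq[of x y x y] skew_adjoint_inner_self[OF T] skew_adjoint_inner_self[OF S]
      skew_adjoint_inner[OF T, of y x] skew_adjoint_inner[OF S, of y x]
    by (simp add: R_anti_def power2_eq_square)
  have "S x \<in> span {T x}" for x
  proof (rule ccontr)
    assume "S x \<notin> span {T x}"
    then obtain z where "T x \<bullet> z = 0" "S x \<bullet> z \<noteq> 0" by (rule separate_from_line)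
    with sq[of x z] c show False by simp
  qed
  moreover have "linear S" "linear T" using S T by (auto simp: skew_adjoint_def)
  ultimately obtain l where l: "\<And>x. S x = l *\<^sub>R T x"
    using scalar_multiple_if_pointwise by blast
  have "(T u \<bullet> T u)\<^sup>2 = c * l\<^sup>2 * (T u \<bullet> T u)\<^sup>2"
    using sq[of u "T u"] by (simp add: l power_mult_distrib)
  then have "c * l\<^sup>2 = 1" using ne by simp
  then show thesis using l that by blast
qed

section \<open>Inserting vectors from a range\<close>

lemma R_canon_self_adjoint: "self_adjoint T \<Longrightarrow> R_canon T = R_sym T"
  by (simp add: R_canon_def)

text \<open>An endomorphism of both builds is \<open>0\<close>, where the two formulas coincide.\<close>

lemma R_canon_skew_adjoint:
  assumes "skew_adjoint T"
  shows "R_canon T = R_anti T"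
proof (cases "self_adjoint T")
  case True
  then have "T x = 0" for x
    using self_adjoint_eq_0_if_quadratic_form_eq_0 skew_adjoint_inner_self[OF assms] by blast
  then have "R_sym T = R_anti T" by (intro ext) (simp add: R_sym_def R_anti_def)
  then show ?thesis by (simp add: R_canon_def)
qed (simp add: R_canon_def)

lemma R_canon_eq_0_on_kernel:
  assumes "S \<circ> T = (\<lambda>x. 0)"
  shows "R_canon S (T x) (T y) (T z) (T w) = 0"
proof -
  have "S (T v) = 0" for v using fun_cong[OF assms, of v] by simp
  then show ?thesis by (simp add: R_canon_def R_sym_def R_anti_def)
qed

lemma conjugate_self_adjoint:
  fixes S T :: "'v::euclidean_space \<Rightarrow> 'v"
  assumes T: "self_adjoint T \<or> skew_adjoint T" and S: "self_adjoint S"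
  shows "self_adjoint (T \<circ> S \<circ> T)"
proof (rule self_adjointI)
  show "linear (T \<circ> S \<circ> T)"
    using T S by (auto simp: self_adjoint_def skew_adjoint_def intro!: linear_compose)
  obtain s where "\<And>x y. T x \<bullet> y = s * (x \<bullet> T y)" using adjoint_sign[OF T] by metis
  then show "(T \<circ> S \<circ> T) x \<bullet> y = (T \<circ> S \<circ> T) y \<bullet> x" for x y
    using self_adjoint_inner[OF S, of "T x" "T y"] by simp
qed

lemma conjugate_skew_adjoint:
  fixes S T :: "'v::euclidean_space \<Rightarrow> 'v"
  assumes T: "self_adjoint T \<or> skew_adjoint T" and S: "skew_adjoint S"
  shows "skew_adjoint (T \<circ> S \<circ> T)"
proof (rule skew_adjointI)
  show "linear (T \<circ> S \<circ> T)"
    using T S by (auto simp: self_adjoint_def skew_adjoint_def intro!: linear_compose)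
  obtain s where "\<And>x y. T x \<bullet> y = s * (x \<bullet> T y)" using adjoint_sign[OF T] by metis
  then show "(T \<circ> S \<circ> T) x \<bullet> y = - ((T \<circ> S \<circ> T) y \<bullet> x)" for x y
    using skew_adjoint_inner[OF S, of "T x" "T y"] by simp
qed

text \<open>Each summand of the tensor is a product of two inner products, so the adjunction sign of \<open>T\<close>
  appears squared, whatever the build of \<open>T\<close>.\<close>

lemma R_sym_R_anti_pullback:
  fixes S T :: "'v::euclidean_space \<Rightarrow> 'v"
  assumes "self_adjoint T \<or> skew_adjoint T"
  shows "R_sym S (T x) (T y) (T z) (T w) = R_sym (T \<circ> S \<circ> T) x y z w"
    and "R_anti S (T x) (T y) (T z) (T w) = R_anti (T \<circ> S \<circ> T) x y z w"
proof -
  obtain s where ss: "s * s = 1" and s: "\<And>x y. T x \<bullet> y = s * (x \<bullet> T y)"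
    using adjoint_sign[OF assms] by metis
  have prod: "(a \<bullet> T b) * (a' \<bullet> T b') = (T a \<bullet> b) * (T a' \<bullet> b')" for a b a' b'
  proof -
    have "(T a \<bullet> b) * (T a' \<bullet> b') = (s * s) * ((a \<bullet> T b) * (a' \<bullet> T b'))"
      by (simp add: s)
    then show ?thesis by (simp add: ss)
  qed
  have prod2: "2 * (a \<bullet> T b) * (a' \<bullet> T b') = 2 * (T a \<bullet> b) * (T a' \<bullet> b')" for a b a' b'
    using prod[of a b a' b'] by simp
  show "R_sym S (T x) (T y) (T z) (T w) = R_sym (T \<circ> S \<circ> T) x y z w"
    unfolding R_sym_def prod by simp
  show "R_anti S (T x) (T y) (T z) (T w) = R_anti (T \<circ> S \<circ> T) x y z w"
    unfolding R_anti_def prod prod2 by simp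
qed

text \<open>The case of two tensors, to which the four-term relation reduces: restricted to the range of
  \<open>T\<close>, the tensors of \<open>S\<close> and \<open>T\<close> become those of \<open>T S T\<close> and \<open>T\<^sup>3\<close>, of the same builds as
  \<open>S\<close> and \<open>T\<close>.\<close>

lemma relation_on_range:
  fixes S T :: "'v::euclidean_space \<Rightarrow> 'v" and e :: real
  assumes T: "self_adjoint T \<or> skew_adjoint T" and S: "self_adjoint S \<or> skew_adjoint S"
    and rank: "dim (range T) \<ge> 3" and e: "e \<in> {1, -1}"
    and rel: "\<And>x y z w. R_canon S (T x) (T y) (T z) (T w) + e * R_canon T (T x) (T y) (T z) (T w) = 0"
  shows "same_build T S" and "T ^^ 3 = T \<circ> S \<circ> T \<or> T ^^ 3 = (\<lambda>x. - (T \<circ> S \<circ> T) x)" and "e = -1"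
proof -
  have cube: "T ^^ 3 = T \<circ> T \<circ> T" by (simp add: numeral_3_eq_3 comp_assoc)
  have rank3: "dim (range (T \<circ> T \<circ> T)) \<ge> 3" using rank rank_cube[OF T] cube by simp
  have "\<exists>u. (T \<circ> T \<circ> T) u \<noteq> 0"
  proof (rule ccontr)
    assume "\<nexists>u. (T \<circ> T \<circ> T) u \<noteq> 0"
    then have "range (T \<circ> T \<circ> T) \<subseteq> span {0, 0}" by auto
    then have "dim (range (T \<circ> T \<circ> T)) \<le> 2" by (rule dim_le_2_if_subset_span_pair)
    with rank3 show False by simp
  qed
  then obtain u where u: "(T \<circ> T \<circ> T) u \<noteq> 0" by blast
  have e0: "- e \<noteq> 0" using e by auto
  have rel': "R_canon T (T x) (T y) (T z) (T w) = (- e) * R_canon S (T x) (T y) (T z) (T w)"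
    for x y z w
    using rel[of x y z w] e by auto
  have key: "same_build T S \<and> (\<exists>l. (- e) * l\<^sup>2 = 1 \<and> (\<forall>x. (T \<circ> S \<circ> T) x = l *\<^sub>R (T \<circ> T \<circ> T) x))"
    using T
  proof
    assume T1: "self_adjoint T"
    have pT: "R_canon T (T x) (T y) (T z) (T w) = R_sym (T \<circ> T \<circ> T) x y z w" for x y z w
      by (simp only: R_canon_self_adjoint[OF T1] R_sym_R_anti_pullback(1)[OF T])
    have TTT: "self_adjoint (T \<circ> T \<circ> T)" by (rule conjugate_self_adjoint[OF T T1])
    from S show ?thesis
    proof
      assume S1: "self_adjoint S"
      have "R_sym (T \<circ> T \<circ> T) x y z w = (- e) * R_sym (T \<circ> S \<circ> T) x y z w" for x y z w
        using rel'[of x y z w]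
        by (simp only: pT R_canon_self_adjoint[OF S1] R_sym_R_anti_pullback(1)[OF T])
      then obtain l where "(- e) * l\<^sup>2 = 1" "\<And>x. (T \<circ> S \<circ> T) x = l *\<^sub>R (T \<circ> T \<circ> T) x"
        using R_sym_rigid[OF _ _ rank3 e0, of "T \<circ> S \<circ> T"] TTT conjugate_self_adjoint[OF T S1]
        unfolding self_adjoint_def by metis
      then show ?thesis using S1 T1 by (auto simp: same_build_def)
    next
      assume S1: "skew_adjoint S"
      have "R_sym (T \<circ> T \<circ> T) x y z w = (- e) * R_anti (T \<circ> S \<circ> T) x y z w" for x y z w
        using rel'[of x y z w]
        by (simp only: pT R_canon_skew_adjoint[OF S1] R_sym_R_anti_pullback(2)[OF T])
      then show ?thesis
        using rank_le_2_if_R_sym_eq_R_anti[OF TTT conjugate_skew_adjoint[OF T S1]] rank3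
        by fastforce
    qed
  next
    assume T1: "skew_adjoint T"
    have pT: "R_canon T (T x) (T y) (T z) (T w) = R_anti (T \<circ> T \<circ> T) x y z w" for x y z w
      by (simp only: R_canon_skew_adjoint[OF T1] R_sym_R_anti_pullback(2)[OF T])
    have TTT: "skew_adjoint (T \<circ> T \<circ> T)" by (rule conjugate_skew_adjoint[OF T T1])
    from S show ?thesis
    proof
      assume S1: "self_adjoint S"
      have "R_anti (T \<circ> T \<circ> T) x y z w = (- e) * R_sym (T \<circ> S \<circ> T) x y z w" for x y z w
        using rel'[of x y z w]
        by (simp only: pT R_canon_self_adjoint[OF S1] R_sym_R_anti_pullback(1)[OF T])
      then show ?thesis
        using rank_le_2_if_R_anti_eq_R_sym[OF TTT conjugate_self_adjoint[OF T S1]] rank3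
        by fastforce
    next
      assume S1: "skew_adjoint S"
      have "R_anti (T \<circ> T \<circ> T) x y z w = (- e) * R_anti (T \<circ> S \<circ> T) x y z w" for x y z w
        using rel'[of x y z w]
        by (simp only: pT R_canon_skew_adjoint[OF S1] R_sym_R_anti_pullback(2)[OF T])
      then obtain l where "(- e) * l\<^sup>2 = 1" "\<And>x. (T \<circ> S \<circ> T) x = l *\<^sub>R (T \<circ> T \<circ> T) x"
        using R_anti_rigid[OF TTT conjugate_skew_adjoint[OF T S1] u e0] by metis
      then show ?thesis using S1 T1 by (auto simp: same_build_def)
    qed
  qed
  then show "same_build T S" by blast
  from key obtain l where el: "(- e) * l\<^sup>2 = 1" and l: "\<And>x. (T \<circ> S \<circ> T) x = l *\<^sub>R (T \<circ> T \<circ> T) x"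
    by blast
  show e1: "e = -1"
  proof (rule ccontr)
    assume "e \<noteq> -1"
    with e have "e = 1" by simp
    with el have "l\<^sup>2 = -1" by simp
    then show False by (metis zero_le_power2 not_one_le_zero neg_0_le_iff_le)
  qed
  with el have "l = 1 \<or> l = -1" by (simp add: power2_eq_1_iff)
  then show "T ^^ 3 = T \<circ> S \<circ> T \<or> T ^^ 3 = (\<lambda>x. - (T \<circ> S \<circ> T) x)"
  proof
    assume "l = 1"
    then have "T ^^ 3 = T \<circ> S \<circ> T" unfolding cube using l by (intro ext) simp
    then show ?thesis ..
  next
    assume "l = -1"
    then have "T ^^ 3 = (\<lambda>x. - (T \<circ> S \<circ> T) x)" unfolding cube using l by (intro ext) simp
    then show ?thesis ..
  qed
qed

section \<open>The chain complex\<close>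

theorem theorem5p6:
  fixes A B C D :: "'v::euclidean_space \<Rightarrow> 'v" and \<epsilon>1 \<epsilon>2 \<epsilon>3 :: real
  assumes "linear A" and "linear B" and "linear C" and "linear D"
    and "self_adjoint A \<or> skew_adjoint A"
    and "self_adjoint B \<or> skew_adjoint B"
    and "self_adjoint C \<or> skew_adjoint C"
    and "self_adjoint D \<or> skew_adjoint D"
    and "B \<circ> A = (\<lambda>x. 0)" and "C \<circ> B = (\<lambda>x. 0)" and "D \<circ> C = (\<lambda>x. 0)"
    and "\<epsilon>1 \<in> {1, -1}" and "\<epsilon>2 \<in> {1, -1}" and "\<epsilon>3 \<in> {1, -1}"
    and "\<And>x y z w. R_canon A x y z w + \<epsilon>1 * R_canon B x y z w
           + \<epsilon>2 * R_canon C x y z w + \<epsilon>3 * R_canon D x y z w = 0"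
    and "dim (range B) \<ge> 4" and "dim (range C) \<ge> 4"
  shows "same_build A C \<and> same_build B D
    \<and> (B ^^ 3 = B \<circ> D \<circ> B \<or> B ^^ 3 = (\<lambda>x. - (B \<circ> D \<circ> B) x))
    \<and> (C ^^ 3 = C \<circ> A \<circ> C \<or> C ^^ 3 = (\<lambda>x. - (C \<circ> A \<circ> C) x))
    \<and> \<epsilon>2 = -1 \<and> \<epsilon>1 = - \<epsilon>3"
proof -
  note adj = assms(5-8) and zero = assms(9-11) and rel = assms(15)
  have AB: "A \<circ> B = (\<lambda>x. 0)" by (rule comp_eq_0_commute[OF adj(2,1) zero(1)])
  have BC: "B \<circ> C = (\<lambda>x. 0)" by (rule comp_eq_0_commute[OF adj(3,2) zero(2)])
  have relB: "R_canon D (B x) (B y) (B z) (B w) + (\<epsilon>1 * \<epsilon>3) * R_canon B (B x) (B y) (B z) (B w) = 0"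
    for x y z w
    using rel[of "B x" "B y" "B z" "B w"] assms(14)
    by (auto simp: R_canon_eq_0_on_kernel[OF AB] R_canon_eq_0_on_kernel[OF zero(2)])
  have relC: "R_canon A (C x) (C y) (C z) (C w) + \<epsilon>2 * R_canon C (C x) (C y) (C z) (C w) = 0"
    for x y z w
    using rel[of "C x" "C y" "C z" "C w"]
    by (simp add: R_canon_eq_0_on_kernel[OF BC] R_canon_eq_0_on_kernel[OF zero(3)])
  have sgn: "\<epsilon>1 * \<epsilon>3 \<in> {1, -1}" using assms(12,14) by auto
  have rankB: "dim (range B) \<ge> 3" and rankC: "dim (range C) \<ge> 3" using assms(16,17) by auto
  note B_concl = relation_on_range[OF adj(2,4) rankB sgn relB]
  note C_concl = relation_on_range[OF adj(3,1) rankC assms(13) relC]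
  have "same_build A C" using C_concl(1) by (auto simp: same_build_def)
  moreover have "\<epsilon>1 = - \<epsilon>3" using B_concl(3) assms(12,14) by auto
  ultimately show ?thesis using B_concl(1,2) C_concl(2,3) by blast
qed

end
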